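(* Let $\mathcal{I}=\{1,\dots,\mathrm{m}\}$, let $\mathcal{A}=\{A_1,\dots,A_{\mathrm{m}}\}\subset\mathbb{R}^{n\times n}$, $\tau>0$ and $\rho>0$. The switched linear system $\dot x(t)=A_{\sigma(t)}x(t)$ is $\tau$-dependent uniformly globally exponentially bounded with decay $\rho$ ($\tau$-UGEB$_\rho$) if and only if there exist norms $v_1,\dots,v_{\mathrm{m}}:\mathbb{R}^n\to\mathbb{R}$ and a number $\alpha\ge0$ such that $$D^+_{A_i}v_i(x)\le-(\rho+\alpha)v_i(x)\qquad\forall i\in\mathcal{I},\ \forall x\in\mathbb{R}^n,$$ $$v_i(x)\le e^{\alpha\tau}v_j(x)\qquad\forall x\in\mathbb{R}^n,\ \forall (i,j)\in\mathcal{I}^2.$$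
   Context: Notation: $\mathbb{R}_+=[0,\infty)$; $|\cdot|$ is the Euclidean norm; $\mathrm{m}\in\mathbb{N}\setminus\{0\}$. Switching signals: $\mathcal{S}$ is the set of piecewise constant, right-continuous functions $\sigma:\mathbb{R}_+\to\mathcal{I}$ (the set of discontinuity points is finite, or infinite and unbounded with finitely many points in each bounded interval). For $\sigma\in\mathcal{S}$ and $0\le s\le t$, $N_\sigma(s,t)$ is the number of discontinuity points of $\sigma$ in $[s,t)$, where by convention the time $0$ is always counted as a discontinuity point. $\Phi_\sigma(t,x)$ is the solution at time $t$ of $\dot x(t)=A_{\sigma(t)}x(t)$, $x(0)=x$. Dini derivative: for a norm $v$ on $\mathbb{R}^n$, $D^+_{A_i}v(x):=\limsup_{h\to0^+}\frac{v(e^{hA_i}x)-v(x)}{h}$. $\tau$-UGEB$_\rho$: the system is $\tau$-dependent uniformly globally exponentially bounded with decay $\rho$ if there exist $M>0$ and $\alpha\ge0$ such that $$|\Phi_\sigma(t,x)|\le M\,e^{\alpha\tau N_\sigma(0,t)}e^{-(\rho+\alpha)t}|x|\qquad\forall\sigma\in\mathcal{S},\ \forall x\in\mathbb{R}^n,\ \forall t\in\mathbb{R}_+.$$ *)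

theory Defs
  imports "HOL-Analysis.Analysis"
begin

(* Matrix multiplication on real^'n^'n is **, not the componentwise times, so the
   library function exp does not apply. *)
definition matrix_exp :: "real^'n^'n \<Rightarrow> real^'n^'n" where
  "matrix_exp A = (\<Sum>k. (1 / fact k) *\<^sub>R (((**) A ^^ k) (mat 1)))"

definition is_norm :: "('a::real_vector \<Rightarrow> real) \<Rightarrow> bool" where
  "is_norm v \<longleftrightarrow>
     (\<forall>x. 0 \<le> v x) \<and>
     (\<forall>x. v x = 0 \<longleftrightarrow> x = 0) \<and>
     (\<forall>c x. v (c *\<^sub>R x) = \<bar>c\<bar> * v x) \<and>
     (\<forall>x y. v (x + y) \<le> v x + v y)"

(* The limsup is taken in the extended reals, where it always exists. *)
definition upper_dini :: "real^'n^'n \<Rightarrow> (real^'n \<Rightarrow> real) \<Rightarrow> real^'n \<Rightarrow> ereal" where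
  "upper_dini A v x =
     Limsup (at_right 0) (\<lambda>h. ereal ((v (matrix_exp (h *\<^sub>R A) *v x) - v x) / h))"

(* Signals are functions on [0,\<infinity>); the values at negative times are never used. *)
definition discontinuities :: "(real \<Rightarrow> nat) \<Rightarrow> real set" where
  "discontinuities \<sigma> = {t. 0 \<le> t \<and> \<not> continuous (at t within {0..}) \<sigma>}"

(* The topology on nat is discrete, so continuity on an interval means constancy there:
   piecewise constancy is the condition on the set of discontinuity points. *)
definition switching_signals :: "nat \<Rightarrow> (real \<Rightarrow> nat) set" where
  "switching_signals m = {\<sigma>.
     (\<forall>t\<ge>0. \<sigma> t \<in> {1..m}) \<and>
     (\<forall>t\<ge>0. continuous (at_right t) \<sigma>) \<and>
     (finite (discontinuities \<sigma>) \<or>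
      infinite (discontinuities \<sigma>) \<and> \<not> bounded (discontinuities \<sigma>) \<and>
        (\<forall>a b. finite (discontinuities \<sigma> \<inter> {a..b})))}"

(* Time 0 is always counted as a discontinuity point. *)
definition switch_count :: "(real \<Rightarrow> nat) \<Rightarrow> real \<Rightarrow> real \<Rightarrow> nat" where
  "switch_count \<sigma> s t = card (insert 0 (discontinuities \<sigma>) \<inter> {s..<t})"

(* A continuous trajectory solves the equation away from the switching times, where in
   general only one-sided derivatives exist. A signal is right-continuous, hence
   continuous at 0 relative to [0,\<infinity>), so the (one-sided) equation at 0 is included. *)
definition solves_switched ::
  "(nat \<Rightarrow> real^'n^'n) \<Rightarrow> (real \<Rightarrow> nat) \<Rightarrow> real^'n \<Rightarrow> (real \<Rightarrow> real^'n) \<Rightarrow> bool" where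
  "solves_switched A \<sigma> x \<phi> \<longleftrightarrow>
     continuous_on {0..} \<phi> \<and> \<phi> 0 = x \<and>
     (\<forall>t\<in>{0..} - discontinuities \<sigma>.
        (\<phi> has_vector_derivative (A (\<sigma> t) *v \<phi> t)) (at t within {0..}))"

(* For a switching signal the solution exists and is unique on [0,\<infinity>), so that its value
   at each t \<ge> 0 is determined. *)
definition flow ::
  "(nat \<Rightarrow> real^'n^'n) \<Rightarrow> (real \<Rightarrow> nat) \<Rightarrow> real \<Rightarrow> real^'n \<Rightarrow> real^'n" where
  "flow A \<sigma> t x = (THE y. \<exists>\<phi>. solves_switched A \<sigma> x \<phi> \<and> \<phi> t = y)"

definition UGEB :: "nat \<Rightarrow> (nat \<Rightarrow> real^'n^'n) \<Rightarrow> real \<Rightarrow> real \<Rightarrow> bool" where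
  "UGEB m A \<tau> \<rho> \<longleftrightarrow>
     (\<exists>M>0. \<exists>\<alpha>\<ge>0. \<forall>\<sigma>\<in>switching_signals m. \<forall>x. \<forall>t\<ge>0.
        norm (flow A \<sigma> t x) \<le>
          M * exp (\<alpha> * \<tau> * real (switch_count \<sigma> 0 t)) * exp (- (\<rho> + \<alpha>) * t) * norm x)"

end

theory Submission
  imports Defs
begin

text \<open>
  Sufficiency of the norms is the multiple Lyapunov function argument. The Dini inequality says that
  \<open>v i\<close> decays along the flow of \<open>A i\<close> at rate \<open>\<rho> + \<alpha>\<close> (\<open>decay_of_upper_dini\<close>), and at each switch the
  change of norm costs a factor \<open>exp (\<alpha> * \<tau>)\<close>. Induction over the intervals of constancy of the signal
  (\<open>switching_signal_induct\<close>, \<open>flow_bound_of_multiple_norms\<close>) multiplies these contributions, and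
  equivalence of norms on a finite-dimensional space returns to the Euclidean norm.

  For the converse, \<open>v i x\<close> is the supremum, over all signals that start in mode \<open>i\<close> and all times \<open>t\<close>,
  of the state reached from \<open>x\<close>, multiplied by \<open>exp ((\<rho> + \<alpha>) * t)\<close> and divided by \<open>exp (\<alpha> * \<tau>)\<close> for every
  switch after time \<open>0\<close> (\<open>worst_growth\<close>). Exponential boundedness makes it finite, and the flow is linear in
  the initial value, so it is a norm. Both inequalities come from prepending a piece of duration \<open>h\<close> in
  mode \<open>j\<close> to a signal that starts in mode \<open>i\<close> (\<open>worst_growth_prepend\<close>). For \<open>j = i\<close> no switch is added,
  so \<open>v i\<close> decays at rate \<open>\<rho> + \<alpha>\<close>. For \<open>j \<noteq> i\<close> one switch is added, and \<open>h\<close> tending to \<open>0\<close> compares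
  \<open>v i\<close> with \<open>v j\<close>.

  The flow is defined by a definite description, so existence and uniqueness of solutions come first.
  Uniqueness (\<open>linear_ode_unique\<close>) also supplies the semigroup law of the exponential, the linearity
  of the flow and its behaviour under concatenation of signals.
\<close>

section \<open>The exponential of a matrix\<close>

abbreviation matrix_power :: "real^'n^'n \<Rightarrow> nat \<Rightarrow> real^'n^'n" where
  "matrix_power A k \<equiv> ((**) A ^^ k) (mat 1)"

lemma matrix_power_scaleR:
  fixes A :: "real^'n^'n"
  shows "matrix_power (t *\<^sub>R A) k = t ^ k *\<^sub>R matrix_power A k"
proof (induction k)
  case (Suc k)
  then show ?case
    by (simp add: vec_eq_iff matrix_matrix_mult_def sum_distrib_left mult_ac)
qed simp

text \<open>Each row of \<open>A\<close> has absolute sum at most the sum over all entries, so one more factor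
  \<open>A\<close> multiplies the entries by at most that constant. This gives each entry of the exponential series
  a scalar exponential as majorant.\<close>
lemma matrix_power_entry_bound:
  fixes A :: "real^'n^'n"
  shows "\<bar>matrix_power A k $ i $ j\<bar> \<le> (\<Sum>i\<in>UNIV. \<Sum>l\<in>UNIV. \<bar>A $ i $ l\<bar>) ^ k"
proof (induction k arbitrary: i)
  case 0
  show ?case by (simp add: mat_def)
next
  case (Suc k)
  let ?C = "\<Sum>i\<in>UNIV. \<Sum>l\<in>UNIV. \<bar>A $ i $ l\<bar>"
  have row: "(\<Sum>l\<in>UNIV. \<bar>A $ i $ l\<bar>) \<le> ?C"
    by (rule member_le_sum) (auto intro: sum_nonneg)
  have C0: "0 \<le> ?C" by (intro sum_nonneg) auto
  have "\<bar>matrix_power A (Suc k) $ i $ j\<bar> = \<bar>\<Sum>l\<in>UNIV. A $ i $ l * matrix_power A k $ l $ j\<bar>"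
    by (simp add: matrix_matrix_mult_def)
  also have "\<dots> \<le> (\<Sum>l\<in>UNIV. \<bar>A $ i $ l\<bar> * ?C ^ k)"
    by (rule order_trans[OF sum_abs]) (auto intro!: sum_mono mult_left_mono Suc.IH simp: abs_mult)
  also have "\<dots> = (\<Sum>l\<in>UNIV. \<bar>A $ i $ l\<bar>) * ?C ^ k" by (simp add: sum_distrib_right)
  also have "\<dots> \<le> ?C * ?C ^ k" by (rule mult_right_mono[OF row]) (simp add: C0)
  finally show ?case by simp
qed

text \<open>The entries of \<open>matrix_exp (t *\<^sub>R A)\<close> are scalar power series in \<open>t\<close> with these coefficients, so that
  termwise differentiation of real power series applies.\<close>
definition exp_coeff :: "real^'n^'n \<Rightarrow> 'n \<Rightarrow> 'n \<Rightarrow> nat \<Rightarrow> real" where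
  "exp_coeff A i j k = matrix_power A k $ i $ j / fact k"

lemma summable_exp_coeff: "summable (\<lambda>k. exp_coeff A i j k * t ^ k)"
proof (rule summable_comparison_test)
  let ?C = "\<Sum>i\<in>UNIV. \<Sum>l\<in>UNIV. \<bar>A $ i $ l\<bar>"
  show "summable (\<lambda>k. inverse (fact k) * (?C * \<bar>t\<bar>) ^ k)" by (rule summable_exp)
  show "\<exists>N. \<forall>k\<ge>N. norm (exp_coeff A i j k * t ^ k) \<le> inverse (fact k) * (?C * \<bar>t\<bar>) ^ k"
    by (auto simp: exp_coeff_def abs_mult power_abs power_mult_distrib field_simps
        intro!: mult_left_mono divide_right_mono matrix_power_entry_bound)
qed

lemma matrix_exp_entry:
  "matrix_exp (t *\<^sub>R A) $ i $ j = (\<Sum>k. exp_coeff A i j k * t ^ k)"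
proof -
  have "(\<lambda>k. (1 / fact k) *\<^sub>R matrix_power (t *\<^sub>R A) k) sums
      (\<chi> i j. \<Sum>k. exp_coeff A i j k * t ^ k)"
    unfolding sums_def
  proof (intro vec_tendstoI)
    fix i j
    have "(\<lambda>n. \<Sum>k<n. exp_coeff A i j k * t ^ k) \<longlonglongrightarrow> (\<Sum>k. exp_coeff A i j k * t ^ k)"
      using summable_exp_coeff by (rule summable_LIMSEQ)
    then show "(\<lambda>n. (\<Sum>k<n. (1 / fact k) *\<^sub>R matrix_power (t *\<^sub>R A) k) $ i $ j)
        \<longlonglongrightarrow> (\<chi> i j. \<Sum>k. exp_coeff A i j k * t ^ k) $ i $ j"
      by (simp add: matrix_power_scaleR exp_coeff_def mult_ac)
  qed
  then show ?thesis
    unfolding matrix_exp_def by (simp add: sums_unique[symmetric])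
qed

lemma matrix_exp_zero: "matrix_exp (0 :: real^'n^'n) = mat 1"
proof -
  have "matrix_exp (0 *\<^sub>R (0 :: real^'n^'n)) $ i $ j = mat 1 $ i $ j" for i j
    unfolding matrix_exp_entry by (simp only: powser_zero) (simp add: exp_coeff_def)
  then show ?thesis by (simp add: vec_eq_iff)
qed

lemma matrix_exp_entry_derivative:
  "((\<lambda>t. matrix_exp (t *\<^sub>R A) $ i $ j) has_field_derivative
     (A ** matrix_exp (t *\<^sub>R A)) $ i $ j) (at t)"
proof -
  have d: "diffs (exp_coeff A i j) k = (\<Sum>l\<in>UNIV. A $ i $ l * exp_coeff A l j k)" for k
    by (simp add: diffs_def exp_coeff_def matrix_matrix_mult_def sum_divide_distrib[symmetric]
        del: of_nat_Suc)
  have "(\<Sum>k. diffs (exp_coeff A i j) k * t ^ k) =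
      (\<Sum>k. \<Sum>l\<in>UNIV. A $ i $ l * (exp_coeff A l j k * t ^ k))"
    by (simp add: d sum_distrib_right sum_distrib_left mult_ac)
  also have "\<dots> = (\<Sum>l\<in>UNIV. \<Sum>k. A $ i $ l * (exp_coeff A l j k * t ^ k))"
    by (intro suminf_sum summable_mult summable_exp_coeff)
  also have "\<dots> = (A ** matrix_exp (t *\<^sub>R A)) $ i $ j"
    by (simp add: matrix_matrix_mult_def matrix_exp_entry suminf_mult[OF summable_exp_coeff])
  finally have e: "(\<Sum>k. diffs (exp_coeff A i j) k * t ^ k) = (A ** matrix_exp (t *\<^sub>R A)) $ i $ j" .
  show ?thesis
    unfolding matrix_exp_entry e[symmetric]
    by (rule termdiffs_strong_converges_everywhere) (rule summable_exp_coeff)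
qed

text \<open>Translating the start to time \<open>s\<close> lets the same fact describe the motion after any switching time.\<close>
lemma matrix_exp_trajectory:
  fixes A :: "real^'n^'n"
  shows
  "((\<lambda>t. matrix_exp ((t - s) *\<^sub>R A) *v x) has_vector_derivative
     A *v (matrix_exp ((t - s) *\<^sub>R A) *v x)) (at t within S)"
proof -
  have "((\<lambda>t. (matrix_exp ((t - s) *\<^sub>R A) *v x) $ i) has_vector_derivative
     (A *v (matrix_exp ((t - s) *\<^sub>R A) *v x)) $ i) (at t within S)" for i
  proof -
    have e: "((\<lambda>t. matrix_exp ((t - s) *\<^sub>R A) $ i $ j) has_field_derivative
       (A ** matrix_exp ((t - s) *\<^sub>R A)) $ i $ j) (at t within S)" for j
    proof -
      have "((\<lambda>t. t - s) has_field_derivative 1) (at t within S)"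
        by (auto intro!: derivative_eq_intros)
      from DERIV_chain2[where f = "\<lambda>t. matrix_exp (t *\<^sub>R A) $ i $ j" and g = "\<lambda>t. t - s",
          OF matrix_exp_entry_derivative this]
      show ?thesis by simp
    qed
    have "((\<lambda>t. \<Sum>j\<in>UNIV. matrix_exp ((t - s) *\<^sub>R A) $ i $ j * x $ j) has_field_derivative
       (\<Sum>j\<in>UNIV. (A ** matrix_exp ((t - s) *\<^sub>R A)) $ i $ j * x $ j)) (at t within S)"
      by (intro DERIV_sum DERIV_cmult_right e)
    then show ?thesis
      unfolding matrix_vector_mul_assoc
      by (simp add: matrix_vector_mult_def has_real_derivative_iff_has_vector_derivative)
  qed
  note component = this[unfolded has_vector_derivative_def]
  show ?thesis
    unfolding has_vector_derivative_def
  proof (subst has_derivative_componentwise_within, rule ballI)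
    fix b :: "real^'n" assume "b \<in> Basis"
    then obtain i where "b = axis i 1" by (auto simp: Basis_vec_def)
    then show "((\<lambda>t. (matrix_exp ((t - s) *\<^sub>R A) *v x) \<bullet> b) has_derivative
        (\<lambda>h. (h *\<^sub>R (A *v (matrix_exp ((t - s) *\<^sub>R A) *v x))) \<bullet> b)) (at t within S)"
      using component[of i] by (simp only: inner_axis' inner_axis inner_real_def mult_1_right vector_scaleR_component real_scaleR_def)
  qed
qed

section \<open>Uniqueness for linear equations\<close>

text \<open>The squared distance of two solutions, damped by \<open>exp (- 2 * L * t)\<close>, has nonpositive derivative.
  The fundamental theorem of calculus tolerates finitely many exceptional points, so a distance that is
  \<open>0\<close> at \<open>a\<close> stays \<open>0\<close> across switching times.\<close>
lemma linear_ode_unique: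
  fixes B :: "real \<Rightarrow> real^'n^'n"
  assumes "finite S" and "a \<le> b"
    and B: "\<And>t y. t \<in> {a..b} \<Longrightarrow> norm (B t *v y) \<le> L * norm y"
    and "continuous_on {a..b} \<phi>" and "continuous_on {a..b} \<psi>" and "\<phi> a = \<psi> a"
    and "\<And>t. t \<in> {a<..<b} - S \<Longrightarrow> (\<phi> has_vector_derivative B t *v \<phi> t) (at t)"
    and "\<And>t. t \<in> {a<..<b} - S \<Longrightarrow> (\<psi> has_vector_derivative B t *v \<psi> t) (at t)"
  shows "\<phi> b = \<psi> b"
proof -
  define \<delta> where "\<delta> t = \<phi> t - \<psi> t" for t
  define g where "g t = exp (- 2 * L * t) * (\<delta> t \<bullet> \<delta> t)" for t
  define g' where "g' t = exp (- 2 * L * t) * (2 * (\<delta> t \<bullet> (B t *v \<delta> t)) - 2 * L * (\<delta> t \<bullet> \<delta> t))" for t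
  have "(g' has_integral (g b - g a)) {a..b}"
  proof (rule fundamental_theorem_of_calculus_interior_strong[OF assms(1,2)])
    show "continuous_on {a..b} g"
      unfolding g_def \<delta>_def using assms by (intro continuous_intros)
  next
    fix t assume t: "t \<in> {a<..<b} - S"
    have "(\<delta> has_vector_derivative B t *v \<delta> t) (at t)"
      unfolding \<delta>_def using assms(7,8)[OF t]
      by (auto intro!: derivative_eq_intros simp: matrix_vector_mult_diff_distrib)
    then show "(g has_vector_derivative g' t) (at t)"
      unfolding g_def g'_def has_vector_derivative_def
      by (auto intro!: derivative_eq_intros simp: algebra_simps inner_commute)
  qed
  moreover have "g' t \<le> 0" if "t \<in> {a..b}" for t
  proof -
    have "\<delta> t \<bullet> (B t *v \<delta> t) \<le> norm (\<delta> t) * (L * norm (\<delta> t))"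
      by (rule order_trans[OF norm_cauchy_schwarz]) (intro mult_left_mono B that norm_ge_zero)
    then show ?thesis
      by (simp add: g'_def mult_le_0_iff power2_norm_eq_inner[symmetric] power2_eq_square algebra_simps)
  qed
  ultimately have "g b - g a \<le> 0"
    using has_integral_nonneg[OF has_integral_neg, of g' "g b - g a" "{a..b}"] by auto
  then have "\<delta> b \<bullet> \<delta> b \<le> 0"
    using assms(6) by (simp add: g_def \<delta>_def mult_le_0_iff)
  then have "\<delta> b = 0" by (metis antisym inner_ge_zero inner_eq_zero_iff)
  then show ?thesis by (simp add: \<delta>_def)
qed

lemma matrix_norm_bound: "norm (A *v y) \<le> onorm ((*v) A) * norm y" for A :: "real^'n^'n"
  by (rule onorm) simp

text \<open>Both sides solve the same linear equation in \<open>t\<close> and agree at \<open>t = 0\<close>; this avoids a Cauchy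
  product of matrix series.\<close>
lemma matrix_exp_add:
  fixes A :: "real^'n^'n"
  assumes "0 \<le> t"
  shows "matrix_exp ((s + t) *\<^sub>R A) *v x = matrix_exp (t *\<^sub>R A) *v (matrix_exp (s *\<^sub>R A) *v x)"
proof -
  let ?\<phi> = "\<lambda>t. matrix_exp ((t - (- s)) *\<^sub>R A) *v x"
  let ?\<psi> = "\<lambda>t. matrix_exp ((t - 0) *\<^sub>R A) *v (matrix_exp (s *\<^sub>R A) *v x)"
  have "?\<phi> t = ?\<psi> t"
    by (rule linear_ode_unique[where S="{}" and B = "\<lambda>_. A", OF _ assms matrix_norm_bound])
       (auto intro!: continuous_on_vector_derivative matrix_exp_trajectory[where s=0, simplified]
          matrix_exp_trajectory[where s="-s", simplified] simp: matrix_exp_zero)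
  then show ?thesis by (simp add: add.commute)
qed

section \<open>Switching signals\<close>

lemma continuous_discrete_iff:
  fixes \<sigma> :: "real \<Rightarrow> nat"
  shows "continuous (at t within S) \<sigma> \<longleftrightarrow> (\<exists>d>0. \<forall>s\<in>S. \<bar>s - t\<bar> < d \<longrightarrow> \<sigma> s = \<sigma> t)"
  by (auto simp: continuous_within tendsto_discrete eventually_at dist_real_def)

text \<open>A bounded set that meets every bounded interval in a finite set is finite, so both alternatives in
  the definition of a switching signal amount to local finiteness of the discontinuities.\<close>
lemma switching_signals_iff:
  "\<sigma> \<in> switching_signals m \<longleftrightarrow>
     (\<forall>t\<ge>0. \<sigma> t \<in> {1..m}) \<and> (\<forall>t\<ge>0. continuous (at_right t) \<sigma>) \<and>
     (\<forall>a b. finite (discontinuities \<sigma> \<inter> {a..b}))"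
proof -
  have "finite D" if bdd: "bounded D" and fin: "\<forall>a b. finite (D \<inter> {a..b})" for D :: "real set"
  proof -
    obtain c where "\<forall>x\<in>D. \<bar>x\<bar> \<le> c" using bdd unfolding bounded_real by blast
    then have "D \<subseteq> {-c..c}" by (auto simp: abs_le_iff)
    with fin show ?thesis by (metis Int_absorb2)
  qed
  then show ?thesis
    unfolding switching_signals_def by blast
qed

text \<open>The signal is continuous on \<open>{s..<T}\<close>, at \<open>s\<close> by right-continuity, and a connected subset of a
  discrete space is a singleton.\<close>
lemma signal_constant_between:
  assumes \<sigma>: "\<sigma> \<in> switching_signals m" and "0 \<le> s" and "discontinuities \<sigma> \<inter> {s<..<T} = {}"
    and "t \<in> {s..<T}"
  shows "\<sigma> t = \<sigma> s"
proof -
  have "continuous_on {s..<T} \<sigma>"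
    unfolding continuous_on_eq_continuous_within
  proof
    fix u assume u: "u \<in> {s..<T}"
    show "continuous (at u within {s..<T}) \<sigma>"
    proof (cases "u = s")
      case True
      have "continuous (at_right s) \<sigma>" using \<sigma> assms(2) by (simp add: switching_signals_iff)
      then show ?thesis unfolding True continuous_discrete_iff
        by (metis atLeastLessThan_iff greaterThan_iff order_le_less)
    next
      case False
      with u assms(2,3) have "0 \<le> u" "u \<notin> discontinuities \<sigma>" by auto
      then have "continuous (at u within {0..}) \<sigma>"
        by (simp add: discontinuities_def)
      then show ?thesis by (rule continuous_within_subset) (use assms in auto)
    qed
  qed
  then have "connected (\<sigma> ` {s..<T})" by (rule connected_continuous_image) auto
  from connectedD[OF this open_discrete open_discrete, of "{\<sigma> s}" "- {\<sigma> s}"]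
  show ?thesis using assms(4) by auto
qed

text \<open>Induction on the number of switches before \<open>T\<close>: the induction step goes from \<open>T\<close> back to the last
  point \<open>s\<close> of \<open>insert 0 (discontinuities \<sigma>)\<close> before \<open>T\<close>. Since \<open>0\<close> is counted, the count rises by exactly
  one on each interval of constancy, including the first.\<close>
lemma switching_signal_induct:
  assumes \<sigma>: "\<sigma> \<in> switching_signals m" and "0 \<le> T"
    and start: "P 0"
    and step: "\<And>s T. \<lbrakk>0 \<le> s; s < T; \<And>t. t \<in> {s..<T} \<Longrightarrow> \<sigma> t = \<sigma> s; s = 0 \<or> s \<in> discontinuities \<sigma>;
        switch_count \<sigma> 0 T = Suc (switch_count \<sigma> 0 s); P s\<rbrakk> \<Longrightarrow> P T"
  shows "P T"
  using assms(2)
proof (induction "switch_count \<sigma> 0 T" arbitrary: T rule: less_induct)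
  case less
  let ?J = "insert 0 (discontinuities \<sigma>)"
  show ?case
  proof (cases "T = 0")
    case False
    with less.prems have T: "0 < T" by simp
    let ?F = "?J \<inter> {0..<T}"
    define s where "s = Max ?F"
    have "finite (discontinuities \<sigma> \<inter> {0..T})" using \<sigma> by (auto simp: switching_signals_iff)
    then have fin: "finite ?F"
      by (rule finite_subset[rotated, OF finite.insertI[of _ 0]]) auto
    have "?F \<noteq> {}" using T by auto
    with fin have "s \<in> ?F" unfolding s_def by (rule Max_in)
    then have s: "s \<in> ?J" "0 \<le> s" "s < T" by auto
    have last: "u \<le> s" if "u \<in> ?F" for u unfolding s_def using fin that by simp
    have eq: "?F = insert s (?J \<inter> {0..<s})"
      using s last by force
    have "u \<notin> discontinuities \<sigma>" if "u \<in> {s<..<T}" for u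
      using last[of u] that s(2) by auto
    then have "discontinuities \<sigma> \<inter> {s<..<T} = {}" by blast
    note const = signal_constant_between[OF \<sigma> s(2) this]
    have "finite (?J \<inter> {0..<s})" by (rule finite_subset[OF _ fin]) (use s in auto)
    then have N: "switch_count \<sigma> 0 T = Suc (switch_count \<sigma> 0 s)"
      unfolding switch_count_def eq by (subst card_insert_disjoint) auto
    show ?thesis
    proof (rule step[OF s(2,3) const _ N])
      show "P s" using N s(2) by (intro less.hyps) auto
    qed (use s in auto)
  qed (use start in simp)
qed

section \<open>Solutions and the flow\<close>

text \<open>Only derivatives at interior points are required. At the end points, which may be switching times,
  continuity carries all the information, so solutions can be cut and glued there.\<close>
definition solves_on ::
  "(nat \<Rightarrow> real^'n^'n) \<Rightarrow> (real \<Rightarrow> nat) \<Rightarrow> real \<Rightarrow> real \<Rightarrow> (real \<Rightarrow> real^'n) \<Rightarrow> bool" where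
  "solves_on A \<sigma> a b \<phi> \<longleftrightarrow> continuous_on {a..b} \<phi> \<and>
     (\<forall>t\<in>{a<..<b} - discontinuities \<sigma>. (\<phi> has_vector_derivative (A (\<sigma> t) *v \<phi> t)) (at t))"

lemma solves_on_subset:
  "solves_on A \<sigma> a b \<phi> \<Longrightarrow> a \<le> a' \<Longrightarrow> b' \<le> b \<Longrightarrow> solves_on A \<sigma> a' b' \<phi>"
  unfolding solves_on_def by (auto elim: continuous_on_subset)

lemma solves_on_cong:
  assumes "solves_on A \<sigma> a b \<phi>" and "\<And>t. t \<in> {a..b} \<Longrightarrow> \<phi> t = \<psi> t"
  shows "solves_on A \<sigma> a b \<psi>"
  unfolding solves_on_def
proof (intro conjI ballI)
  show "continuous_on {a..b} \<psi>"
    using assms by (metis (no_types, lifting) continuous_on_cong solves_on_def)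
next
  fix t assume t: "t \<in> {a<..<b} - discontinuities \<sigma>"
  then have "(\<phi> has_vector_derivative (A (\<sigma> t) *v \<psi> t)) (at t)"
    using assms by (auto simp: solves_on_def)
  then show "(\<psi> has_vector_derivative (A (\<sigma> t) *v \<psi> t)) (at t)"
    by (rule has_vector_derivative_transform_within_open[of _ _ _ "{a<..<b}"]) (use t assms in auto)
qed

lemma solves_on_append:
  assumes "solves_on A \<sigma> a b \<phi>" and "solves_on A \<sigma> b c \<psi>" and "\<phi> b = \<psi> b"
    and "b \<in> discontinuities \<sigma>"
  shows "solves_on A \<sigma> a c (\<lambda>t. if t \<le> b then \<phi> t else \<psi> t)"
  unfolding solves_on_def
proof (intro conjI ballI)
  show "continuous_on {a..c} (\<lambda>t. if t \<le> b then \<phi> t else \<psi> t)"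
    using assms by (intro continuous_on_cases_le) (auto simp: solves_on_def elim: continuous_on_subset)
next
  fix t assume t: "t \<in> {a<..<c} - discontinuities \<sigma>"
  with assms(4) have "t \<noteq> b" by auto
  then consider "t < b" | "b < t" by linarith
  then show "((\<lambda>t. if t \<le> b then \<phi> t else \<psi> t) has_vector_derivative
      (A (\<sigma> t) *v (if t \<le> b then \<phi> t else \<psi> t))) (at t)"
  proof cases
    case 1
    then have "(\<phi> has_vector_derivative (A (\<sigma> t) *v \<phi> t)) (at t)"
      using t assms by (auto simp: solves_on_def)
    then show ?thesis using 1
      by (auto intro: has_vector_derivative_transform_within_open[of _ _ _ "{..<b}"])
  next
    case 2
    then have "(\<psi> has_vector_derivative (A (\<sigma> t) *v \<psi> t)) (at t)"
      using t assms by (auto simp: solves_on_def)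
    then show ?thesis using 2
      by (auto intro: has_vector_derivative_transform_within_open[of _ _ _ "{b<..}"])
  qed
qed

lemma solves_on_exp:
  assumes "\<And>t. t \<in> {s<..<T} \<Longrightarrow> \<sigma> t = k"
  shows "solves_on A \<sigma> s T (\<lambda>t. matrix_exp ((t - s) *\<^sub>R A k) *v y)"
  unfolding solves_on_def
  using assms by (auto intro!: continuous_on_vector_derivative matrix_exp_trajectory)

lemma solves_on_unique:
  assumes \<sigma>: "\<sigma> \<in> switching_signals m" and "0 \<le> a" and "t \<in> {a..b}"
    and "solves_on A \<sigma> a b \<phi>" and "solves_on A \<sigma> a b \<psi>" and "\<phi> a = \<psi> a"
  shows "\<phi> t = \<psi> t"
proof (rule linear_ode_unique)
  show "finite (discontinuities \<sigma> \<inter> {a..t})" using \<sigma> by (simp add: switching_signals_iff)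
  \<comment> \<open>The sum over all modes serves as a common Lipschitz constant.\<close>
  show "norm (A (\<sigma> u) *v y) \<le> (\<Sum>i\<in>{1..m}. onorm ((*v) (A i))) * norm y" if "u \<in> {a..t}" for u y
  proof -
    have "\<sigma> u \<in> {1..m}" using \<sigma> that assms(2) by (simp add: switching_signals_iff)
    then have "onorm ((*v) (A (\<sigma> u))) \<le> (\<Sum>i\<in>{1..m}. onorm ((*v) (A i)))"
      by (intro member_le_sum) (auto intro: onorm_pos_le)
    then show ?thesis by (meson matrix_norm_bound mult_right_mono norm_ge_zero order_trans)
  qed
qed (use assms in \<open>auto simp: solves_on_def elim: continuous_on_subset\<close>)

text \<open>On each interval of constancy the solution is continued by the matrix exponential.\<close>
lemma solution_exists_on:
  fixes A :: "nat \<Rightarrow> real^'n^'n"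
  assumes \<sigma>: "\<sigma> \<in> switching_signals m" and "0 \<le> T"
  shows "\<exists>\<phi>. \<phi> 0 = x \<and> solves_on A \<sigma> 0 T \<phi>"
proof (rule switching_signal_induct[OF assms])
  show "\<exists>\<phi>. \<phi> 0 = x \<and> solves_on A \<sigma> 0 0 \<phi>"
    by (intro exI[of _ "\<lambda>_. x"]) (simp add: solves_on_def)
next
  fix s T :: real
  assume s: "0 \<le> s" "s < T" "s = 0 \<or> s \<in> discontinuities \<sigma>"
    and const: "\<And>t. t \<in> {s..<T} \<Longrightarrow> \<sigma> t = \<sigma> s"
    and IH: "\<exists>\<phi>. \<phi> 0 = x \<and> solves_on A \<sigma> 0 s \<phi>"
  from IH obtain \<phi> where \<phi>: "\<phi> 0 = x" "solves_on A \<sigma> 0 s \<phi>" by blast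
  let ?\<psi> = "\<lambda>t. matrix_exp ((t - s) *\<^sub>R A (\<sigma> s)) *v \<phi> s"
  have \<psi>: "solves_on A \<sigma> s T ?\<psi>" by (intro solves_on_exp const) simp
  show "\<exists>\<phi>. \<phi> 0 = x \<and> solves_on A \<sigma> 0 T \<phi>"
  proof (cases "s = 0")
    case True
    with \<phi>(1) \<psi> show ?thesis by (intro exI[of _ ?\<psi>]) (simp add: matrix_exp_zero)
  next
    case False
    with s have "s \<in> discontinuities \<sigma>" by auto
    from solves_on_append[OF \<phi>(2) \<psi> _ this] \<phi>(1) s(1) show ?thesis
      by (intro exI[of _ "\<lambda>t. if t \<le> s then \<phi> t else ?\<psi> t"]) (simp add: matrix_exp_zero)
  qed
qed

text \<open>The one-sided equation at time \<open>0\<close> comes for free: the signal is constant just after \<open>0\<close>, so by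
  uniqueness the solution is a matrix exponential there.\<close>
lemma solves_switched_iff:
  fixes A :: "nat \<Rightarrow> real^'n^'n"
  assumes \<sigma>: "\<sigma> \<in> switching_signals m"
  shows "solves_switched A \<sigma> x \<phi> \<longleftrightarrow> \<phi> 0 = x \<and> (\<forall>T\<ge>0. solves_on A \<sigma> 0 T \<phi>)"
proof (intro iffI conjI allI impI; (elim conjE)?)
  fix T :: real
  assume sol: "solves_switched A \<sigma> x \<phi>"
  have "at t = at t within {0..}" if "t \<in> {0<..<T}" for t
    using that at_within_interior[of t "{0..}"] by simp
  with sol show "solves_on A \<sigma> 0 T \<phi>"
    unfolding solves_switched_def solves_on_def by (auto elim: continuous_on_subset)
next
  assume "solves_switched A \<sigma> x \<phi>"
  then show "\<phi> 0 = x" by (simp add: solves_switched_def)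
next
  assume x: "\<phi> 0 = x" and sol: "\<forall>T\<ge>0. solves_on A \<sigma> 0 T \<phi>"
  have interior: "isCont \<phi> t" if "0 < t" for t
    using sol[rule_format, of "t + 1"] that
    by (auto simp: solves_on_def intro: continuous_on_interior)
  have "continuous (at_right 0) \<sigma>" using \<sigma> by (simp add: switching_signals_iff)
  then obtain d where d: "d > 0" "\<And>s. 0 < s \<Longrightarrow> s < d \<Longrightarrow> \<sigma> s = \<sigma> 0"
    unfolding continuous_discrete_iff by auto
  let ?\<psi> = "\<lambda>t. matrix_exp ((t - 0) *\<^sub>R A (\<sigma> 0)) *v x"
  have near: "\<phi> t = ?\<psi> t" if "t \<in> {0..d}" for t
    by (rule solves_on_unique[OF \<sigma> order_refl that, of A])
       (use sol x d in \<open>auto intro!: solves_on_exp[where s=0, simplified] simp: matrix_exp_zero\<close>)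
  have "?\<psi> 0 = \<phi> 0" by (simp add: matrix_exp_zero x)
  with matrix_exp_trajectory[of 0 "A (\<sigma> 0)" x 0 "{0..}"]
  have "(?\<psi> has_vector_derivative A (\<sigma> 0) *v \<phi> 0) (at 0 within {0..})" by (simp only:)
  then have zero: "(\<phi> has_vector_derivative A (\<sigma> 0) *v \<phi> 0) (at 0 within {0..})"
  proof (rule has_vector_derivative_transform_within[OF _ d(1)])
    fix t :: real assume "t \<in> {0..}" "dist t 0 < d"
    then show "?\<psi> t = \<phi> t" by (intro near[symmetric]) (simp add: dist_real_def)
  qed simp
  have deriv: "(\<phi> has_vector_derivative A (\<sigma> t) *v \<phi> t) (at t within {0..})"
    if "t \<in> {0..} - discontinuities \<sigma>" for t
  proof (cases "t = 0")
    case False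
    with that sol[rule_format, of "t + 1"] show ?thesis
      by (auto simp: solves_on_def intro: has_vector_derivative_at_within)
  qed (use zero in simp)
  have "continuous (at t within {0..}) \<phi>" if "0 \<le> t" for t
  proof (cases "t = 0")
    case True
    with zero show ?thesis by (auto intro: has_vector_derivative_continuous)
  next
    case False
    with that interior show ?thesis by (auto intro: continuous_at_imp_continuous_at_within)
  qed
  then have "continuous_on {0..} \<phi>" by (simp add: continuous_on_eq_continuous_within)
  with deriv x show "solves_switched A \<sigma> x \<phi>"
    unfolding solves_switched_def by blast
qed

text \<open>The solutions on the intervals \<open>{0..T}\<close> are restrictions of each other by uniqueness, so their end
  values \<open>\<Phi> t t\<close> form one solution on \<open>{0..}\<close>.\<close>
lemma solution_exists:
  fixes A :: "nat \<Rightarrow> real^'n^'n"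
  assumes \<sigma>: "\<sigma> \<in> switching_signals m"
  shows "\<exists>\<phi>. solves_switched A \<sigma> x \<phi>"
proof -
  define \<Phi> where "\<Phi> T = (SOME \<phi>. \<phi> 0 = x \<and> solves_on A \<sigma> 0 T \<phi>)" for T
  have \<Phi>: "\<Phi> T 0 = x" "solves_on A \<sigma> 0 T (\<Phi> T)" if "0 \<le> T" for T
    using someI_ex[OF solution_exists_on[OF \<sigma> that, of x A]] unfolding \<Phi>_def by simp_all
  have agree: "\<Phi> T t = \<Phi> t t" if "0 \<le> t" "t \<le> T" for t T
  proof (rule solves_on_unique[OF \<sigma> order_refl, where \<phi> = "\<Phi> T" and \<psi> = "\<Phi> t"])
    have "solves_on A \<sigma> 0 T (\<Phi> T)" by (rule \<Phi>) (use that in simp)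
    then show "solves_on A \<sigma> 0 t (\<Phi> T)" by (rule solves_on_subset) (use that in simp_all)
    show "solves_on A \<sigma> 0 t (\<Phi> t)" by (rule \<Phi>) (rule that)
    show "\<Phi> T 0 = \<Phi> t 0" using \<Phi>(1)[of t] \<Phi>(1)[of T] that by simp
  qed (use that in simp)
  define \<psi> where "\<psi> t = \<Phi> t t" for t
  have "solves_on A \<sigma> 0 T \<psi>" if "0 \<le> T" for T
  proof (rule solves_on_cong)
    show "solves_on A \<sigma> 0 T (\<Phi> T)" using that by (rule \<Phi>)
    show "\<Phi> T t = \<psi> t" if "t \<in> {0..T}" for t
      unfolding \<psi>_def by (rule agree) (use that in auto)
  qed
  moreover have "\<psi> 0 = x" using \<Phi>(1)[of 0] by (simp add: \<psi>_def)
  ultimately have "solves_switched A \<sigma> x \<psi>"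
    unfolding solves_switched_iff[OF \<sigma>] by simp
  then show ?thesis by (intro exI[of _ \<psi>])
qed

text \<open>Together with \<open>flow_solves\<close> this replaces the definite description in \<open>flow\<close> in all that follows.\<close>
lemma flow_eq:
  assumes \<sigma>: "\<sigma> \<in> switching_signals m" and "0 \<le> T" and "solves_on A \<sigma> 0 T \<phi>"
  shows "flow A \<sigma> T (\<phi> 0) = \<phi> T"
  unfolding flow_def
proof (rule the_equality)
  have unique: "\<psi> T = \<phi> T" if "solves_switched A \<sigma> (\<phi> 0) \<psi>" for \<psi>
  proof (rule solves_on_unique[OF \<sigma> order_refl _ _ assms(3)])
    from that show "solves_on A \<sigma> 0 T \<psi>" "\<psi> 0 = \<phi> 0"
      using assms(2) unfolding solves_switched_iff[OF \<sigma>] by blast+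
  qed (use assms(2) in simp)
  obtain \<psi> where \<psi>: "solves_switched A \<sigma> (\<phi> 0) \<psi>" using solution_exists[OF \<sigma>] by blast
  with unique[OF \<psi>] show "\<exists>\<psi>. solves_switched A \<sigma> (\<phi> 0) \<psi> \<and> \<psi> T = \<phi> T" by blast
  fix y assume "\<exists>\<psi>. solves_switched A \<sigma> (\<phi> 0) \<psi> \<and> \<psi> T = y"
  then obtain \<eta> where "solves_switched A \<sigma> (\<phi> 0) \<eta>" and "\<eta> T = y" by blast
  with unique[of \<eta>] show "y = \<phi> T" by simp
qed

lemma flow_solves:
  assumes \<sigma>: "\<sigma> \<in> switching_signals m"
  shows "flow A \<sigma> 0 x = x" and "solves_on A \<sigma> 0 T (\<lambda>t. flow A \<sigma> t x)"
proof -
  obtain \<phi> where \<phi>: "solves_switched A \<sigma> x \<phi>" using solution_exists[OF \<sigma>] by blast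
  then have eq: "flow A \<sigma> t x = \<phi> t" if "0 \<le> t" for t
    using flow_eq[OF \<sigma> that, of A \<phi>] that by (simp add: solves_switched_iff[OF \<sigma>])
  from eq \<phi> show "flow A \<sigma> 0 x = x" by (simp add: solves_switched_def)
  show "solves_on A \<sigma> 0 T (\<lambda>t. flow A \<sigma> t x)"
  proof (cases "0 \<le> T")
    case True
    with \<phi> have "solves_on A \<sigma> 0 T \<phi>" by (simp add: solves_switched_iff[OF \<sigma>])
    then show ?thesis by (rule solves_on_cong) (simp add: eq)
  qed (simp add: solves_on_def)
qed

lemma flow_exp:
  assumes \<sigma>: "\<sigma> \<in> switching_signals m" and "0 \<le> s" "s \<le> T" and "\<And>t. t \<in> {s<..<T} \<Longrightarrow> \<sigma> t = k"
  shows "flow A \<sigma> T x = matrix_exp ((T - s) *\<^sub>R A k) *v flow A \<sigma> s x"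
proof (rule solves_on_unique[OF \<sigma> assms(2), where \<phi> = "\<lambda>t. flow A \<sigma> t x"
      and \<psi> = "\<lambda>t. matrix_exp ((t - s) *\<^sub>R A k) *v flow A \<sigma> s x"])
  show "solves_on A \<sigma> s T (\<lambda>t. flow A \<sigma> t x)"
    by (rule solves_on_subset[OF flow_solves(2)[OF \<sigma>, of A T x]]) (use assms(2) in simp_all)
  show "solves_on A \<sigma> s T (\<lambda>t. matrix_exp ((t - s) *\<^sub>R A k) *v flow A \<sigma> s x)"
    by (rule solves_on_exp) (rule assms(4))
qed (use assms(3) in \<open>simp_all add: matrix_exp_zero\<close>)

lemma flow_add:
  assumes \<sigma>: "\<sigma> \<in> switching_signals m" and "0 \<le> T"
  shows "flow A \<sigma> T (x + y) = flow A \<sigma> T x + flow A \<sigma> T y"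
proof -
  have "solves_on A \<sigma> 0 T (\<lambda>t. flow A \<sigma> t x + flow A \<sigma> t y)"
    using flow_solves(2)[OF \<sigma>, of A T x] flow_solves(2)[OF \<sigma>, of A T y]
    unfolding solves_on_def
    by (auto intro!: continuous_intros has_vector_derivative_add simp: matrix_vector_right_distrib)
  from flow_eq[OF \<sigma> assms(2) this] show ?thesis by (simp add: flow_solves(1)[OF \<sigma>])
qed

lemma flow_scaleR:
  assumes \<sigma>: "\<sigma> \<in> switching_signals m" and "0 \<le> T"
  shows "flow A \<sigma> T (c *\<^sub>R x) = c *\<^sub>R flow A \<sigma> T x"
proof -
  have "solves_on A \<sigma> 0 T (\<lambda>t. c *\<^sub>R flow A \<sigma> t x)"
    using flow_solves(2)[OF \<sigma>, of A T x]
    unfolding solves_on_def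
    by (auto intro!: continuous_intros derivative_eq_intros simp: matrix_vector_mult_scaleR)
  from flow_eq[OF \<sigma> assms(2) this] show ?thesis by (simp add: flow_solves(1)[OF \<sigma>])
qed

section \<open>Norms and Dini derivatives along trajectories\<close>

text \<open>At the last time in \<open>{0..T}\<close> where \<open>f\<close> is nonpositive, \<open>f\<close> stays nonpositive a little longer, by
  continuity or by assumption; so this time is \<open>T\<close>.\<close>
lemma nonpos_by_right_continuation:
  fixes f :: "real \<Rightarrow> real"
  assumes cont: "continuous_on {0..T} f" and "0 \<le> T" and "f 0 \<le> 0"
    and right: "\<And>s. \<lbrakk>0 \<le> s; s < T; f s = 0\<rbrakk> \<Longrightarrow> \<forall>\<^sub>F t in at_right s. f t \<le> 0"
  shows "f T \<le> 0"
proof -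
  let ?Z = "{t \<in> {0..T}. f t \<le> 0}"
  have "closed ?Z"
    using continuous_on_closed_Collect_le[OF cont continuous_on_const closed_atLeastAtMost] by simp
  moreover have "bounded ?Z" by (rule bounded_subset[OF bounded_closed_interval[of 0 T]]) auto
  ultimately have "compact ?Z" by (simp add: compact_eq_bounded_closed)
  moreover have "?Z \<noteq> {}" using assms(2,3) by force
  ultimately obtain s where s: "s \<in> ?Z" "\<And>t. t \<in> ?Z \<Longrightarrow> t \<le> s"
    using compact_attains_sup[of ?Z] by blast
  show ?thesis
  proof (cases "s = T")
    case False
    with s(1) have sT: "0 \<le> s" "s < T" by auto
    have "\<forall>\<^sub>F t in at_right s. f t \<le> 0"
    proof (cases "f s = 0")
      case False
      with s(1) have "f s < 0" by simp
      moreover have "(f \<longlongrightarrow> f s) (at s within {0..T})"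
        using cont sT by (simp add: continuous_on)
      then have "(f \<longlongrightarrow> f s) (at s within {s..T})"
        by (rule tendsto_within_subset) (use sT in auto)
      ultimately have "\<forall>\<^sub>F t in at s within {s..T}. f t < 0" by (rule order_tendstoD(2)[rotated])
      then show ?thesis
        using sT by (simp add: at_within_Icc_at_right eventually_mono less_imp_le)
    qed (use right sT in blast)
    moreover have "\<forall>\<^sub>F t in at_right s. t \<in> {s<..<T}" using sT(2) by (rule eventually_at_right_real)
    ultimately have "\<forall>\<^sub>F t in at_right s. False"
    proof eventually_elim
      case (elim t)
      with s(2)[of t] sT show ?case by auto
    qed
    then show ?thesis by (simp add: trivial_limit_def[symmetric])
  qed (use s in simp)
qed

lemma is_normD:
  assumes "is_norm v"
  shows "0 \<le> v x" and "v x = 0 \<longleftrightarrow> x = 0" and "v (c *\<^sub>R x) = \<bar>c\<bar> * v x" and "v (x + y) \<le> v x + v y"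
  using assms unfolding is_norm_def by blast+

lemma is_norm_upper_bound:
  fixes v :: "'a::euclidean_space \<Rightarrow> real"
  assumes v: "is_norm v"
  obtains b where "b > 0" and "\<And>x. v x \<le> b * norm x"
proof
  let ?b = "1 + (\<Sum>e\<in>Basis. v e)"
  show "?b > 0" using is_normD(1)[OF v] by (simp add: add_pos_nonneg sum_nonneg)
  fix x
  have sub: "v (\<Sum>e\<in>F. f e) \<le> (\<Sum>e\<in>F. v (f e))" if "finite F" for F and f :: "'a \<Rightarrow> 'a"
    using that
  proof (induction F)
    case empty
    then show ?case using is_normD(2)[OF v, of 0] by simp
  next
    case (insert e F)
    then show ?case using is_normD(4)[OF v, of "f e" "sum f F"] by simp
  qed
  have "v x = v (\<Sum>e\<in>Basis. (x \<bullet> e) *\<^sub>R e)" by (simp add: euclidean_representation)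
  also have "\<dots> \<le> (\<Sum>e\<in>Basis. \<bar>x \<bullet> e\<bar> * v e)"
    using sub[of Basis "\<lambda>e. (x \<bullet> e) *\<^sub>R e"] by (simp add: is_normD(3)[OF v])
  also have "\<dots> \<le> (\<Sum>e\<in>Basis. norm x * v e)"
    by (intro sum_mono mult_right_mono Basis_le_norm is_normD(1)[OF v])
  also have "\<dots> \<le> ?b * norm x" by (simp add: sum_distrib_left[symmetric] algebra_simps)
  finally show "v x \<le> ?b * norm x" .
qed

lemma is_norm_continuous:
  fixes v :: "'a::euclidean_space \<Rightarrow> real"
  assumes v: "is_norm v"
  shows "continuous_on S v"
proof -
  obtain b where b: "b > 0" "\<And>x. v x \<le> b * norm x" using is_norm_upper_bound[OF v] by blast
  have "b-lipschitz_on S v"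
  proof (rule lipschitz_onI)
    fix x y
    have "v (y - x) = v (x - y)" using is_normD(3)[OF v, of "- 1" "x - y"] by simp
    moreover have "v x \<le> v y + v (x - y)" "v y \<le> v x + v (y - x)"
      using is_normD(4)[OF v, of y "x - y"] is_normD(4)[OF v, of x "y - x"] by simp_all
    ultimately show "dist (v x) (v y) \<le> b * dist x y"
      using b(2)[of "x - y"] by (simp add: dist_norm)
  qed (use b in simp)
  then show ?thesis by (rule lipschitz_on_continuous_on)
qed

lemma is_norm_lower_bound:
  fixes v :: "'a::euclidean_space \<Rightarrow> real"
  assumes v: "is_norm v"
  obtains a where "a > 0" and "\<And>x. norm x \<le> a * v x"
proof -
  have "compact (sphere (0::'a) 1)" "sphere (0::'a) 1 \<noteq> {}" by auto
  from continuous_attains_inf[OF this is_norm_continuous[OF v]]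
  obtain z where z: "norm z = 1" "\<And>y. norm y = 1 \<Longrightarrow> v z \<le> v y" by auto
  have pos: "v z > 0" using is_normD(1,2)[OF v, of z] z(1) by force
  show thesis
  proof (rule that[of "1 / v z"])
    fix x
    show "norm x \<le> 1 / v z * v x"
    proof (cases "x = 0")
      case False
      then have "v z \<le> v ((1 / norm x) *\<^sub>R x)" by (intro z(2)) simp
      with False pos show ?thesis by (simp add: is_normD(3)[OF v] field_simps)
    qed (use is_normD(1)[OF v] pos in simp)
  qed (use pos in simp)
qed

text \<open>The norm along a trajectory is compared with \<open>exp (- (c - \<epsilon>) * t) * v x\<close>. Where the two meet, the Dini
  bound makes the norm decrease faster than the comparison function, so it never gets above it; then
  \<open>\<epsilon>\<close> tends to \<open>0\<close>. The case \<open>x = 0\<close> is separate because the comparison function must be positive.\<close>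
lemma decay_of_upper_dini:
  fixes A :: "real^'n^'n"
  assumes v: "is_norm v" and dini: "\<And>x. upper_dini A v x \<le> ereal (- c * v x)" and "0 \<le> t"
  shows "v (matrix_exp (t *\<^sub>R A) *v x) \<le> exp (- c * t) * v x"
proof (cases "x = 0")
  case True
  then show ?thesis using is_normD(2)[OF v, of 0] by simp
next
  case False
  then have x: "v x > 0" using is_normD(1,2)[OF v, of x] by force
  have loose: "v (matrix_exp (t *\<^sub>R A) *v x) \<le> exp (- (c - \<epsilon>) * t) * v x" if "\<epsilon> > 0" for \<epsilon>
  proof -
    define u where "u s = exp (- (c - \<epsilon>) * s) * v x" for s
    define \<phi> where "\<phi> s = matrix_exp (s *\<^sub>R A) *v x" for s
    have "continuous_on UNIV \<phi>"
      unfolding \<phi>_def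
      by (rule continuous_on_vector_derivative) (rule matrix_exp_trajectory[where s=0, simplified])
    then have cont: "continuous_on S (\<lambda>s. v (\<phi> s))" for S
      by (intro continuous_on_compose2[OF is_norm_continuous[OF v, of UNIV]])
         (auto elim: continuous_on_subset)
    have "v (\<phi> t) - u t \<le> 0"
    proof (rule nonpos_by_right_continuation[where f="\<lambda>s. v (\<phi> s) - u s", OF _ assms(3)])
      show "continuous_on {0..t} (\<lambda>s. v (\<phi> s) - u s)"
        unfolding u_def by (intro continuous_intros cont)
      show "v (\<phi> 0) - u 0 \<le> 0" by (simp add: \<phi>_def u_def matrix_exp_zero)
    next
      fix s assume s: "0 \<le> s" and "v (\<phi> s) - u s = 0"
      then have touch: "v (\<phi> s) = u s" by simp
      have us: "u s > 0" using x by (simp add: u_def)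
      \<comment> \<open>The slope \<open>- (c - \<epsilon> / 2) * u s\<close> separates the slopes of the norm and of \<open>u\<close> at \<open>s\<close>.\<close>
      have "upper_dini A v (\<phi> s) < ereal (- (c - \<epsilon> / 2) * u s)"
        using \<open>\<epsilon> > 0\<close> us
        by (intro le_less_trans[OF dini]) (simp add: touch algebra_simps)
      then have "\<forall>\<^sub>F h in at_right 0.
          (v (matrix_exp (h *\<^sub>R A) *v \<phi> s) - v (\<phi> s)) / h < - (c - \<epsilon> / 2) * u s"
        unfolding upper_dini_def by (auto dest: Limsup_lessD)
      moreover have "(u has_field_derivative - (c - \<epsilon>) * u s) (at s)"
        unfolding u_def by (auto intro!: derivative_eq_intros)
      then have "((\<lambda>h. (u (s + h) - u s) / h) \<longlongrightarrow> - (c - \<epsilon>) * u s) (at_right 0)"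
        by (intro filterlim_mono[OF DERIV_D]) (auto simp: at_le)
      then have "\<forall>\<^sub>F h in at_right 0. - (c - \<epsilon> / 2) * u s < (u (s + h) - u s) / h"
        by (rule order_tendstoD(1)) (use \<open>\<epsilon> > 0\<close> us in \<open>simp add: algebra_simps\<close>)
      moreover have "\<forall>\<^sub>F h::real in at_right 0. 0 < h" by (simp add: eventually_at_right_less)
      ultimately have "\<forall>\<^sub>F h in at_right 0. v (\<phi> (h + s)) - u (h + s) \<le> 0"
      proof eventually_elim
        case (elim h)
        then have "(v (matrix_exp (h *\<^sub>R A) *v \<phi> s) - v (\<phi> s)) / h < (u (s + h) - u s) / h" by linarith
        with elim(3) have "v (matrix_exp (h *\<^sub>R A) *v \<phi> s) < u (s + h)"
          by (simp add: divide_less_cancel touch)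
        moreover have "\<phi> (h + s) = matrix_exp (h *\<^sub>R A) *v \<phi> s"
          using matrix_exp_add[of h s A x] elim(3) by (simp add: \<phi>_def add.commute)
        ultimately show ?case by (simp add: add.commute)
      qed
      then show "\<forall>\<^sub>F t in at_right s. v (\<phi> t) - u t \<le> 0"
        by (subst eventually_at_right_to_0)
    qed
    then show ?thesis by (simp add: \<phi>_def u_def)
  qed
  have "((\<lambda>\<epsilon>. exp (- (c - \<epsilon>) * t) * v x) \<longlongrightarrow> exp (- (c - 0) * t) * v x) (at_right 0)"
    by (intro tendsto_intros)
  then show ?thesis
    using loose by (intro tendsto_lowerbound[of _ "exp (- c * t) * v x" "at_right 0"])
      (auto simp: eventually_at_right_less intro: eventually_mono[OF eventually_at_right_less])
qed

lemma upper_dini_of_decay: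
  fixes A :: "real^'n^'n"
  assumes "\<And>h. 0 < h \<Longrightarrow> v (matrix_exp (h *\<^sub>R A) *v x) \<le> exp (- c * h) * v x"
  shows "upper_dini A v x \<le> ereal (- c * v x)"
proof -
  have "((\<lambda>h. exp (- c * h) * v x) has_field_derivative - c * v x) (at 0)"
    by (auto intro!: derivative_eq_intros)
  then have "((\<lambda>h. (exp (- c * h) * v x - v x) / h) \<longlongrightarrow> - c * v x) (at 0)"
    by (drule_tac DERIV_D) simp
  then have "((\<lambda>h. (exp (- c * h) * v x - v x) / h) \<longlongrightarrow> - c * v x) (at_right 0)"
    by (rule filterlim_mono) (auto simp: at_le)
  then have lim: "Limsup (at_right 0) (\<lambda>h. ereal ((exp (- c * h) * v x - v x) / h)) = ereal (- c * v x)"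
    by (intro lim_imp_Limsup tendsto_ereal) simp_all
  have "\<forall>\<^sub>F h in at_right 0. ereal ((v (matrix_exp (h *\<^sub>R A) *v x) - v x) / h)
      \<le> ereal ((exp (- c * h) * v x - v x) / h)"
  proof (rule eventually_mono[OF eventually_at_right_less])
    fix h :: real assume "0 < h"
    with assms[of h] show "ereal ((v (matrix_exp (h *\<^sub>R A) *v x) - v x) / h)
        \<le> ereal ((exp (- c * h) * v x - v x) / h)"
      by (simp add: divide_right_mono)
  qed
  then show ?thesis
    unfolding upper_dini_def lim[symmetric] by (rule Limsup_mono)
qed

section \<open>From norms to exponential boundedness\<close>

text \<open>On each interval of constancy the norm of the active mode decays; the factor \<open>exp d\<close> is spent at the
  end of the interval to pass to an arbitrary norm. Bounding all norms at once in the induction means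
  that the mode of the next interval need not be known.\<close>
lemma flow_bound_of_multiple_norms:
  fixes A :: "nat \<Rightarrow> real^'n^'n"
  assumes norms: "\<And>i. i \<in> {1..m} \<Longrightarrow> is_norm (v i)"
    and dini: "\<And>i x. i \<in> {1..m} \<Longrightarrow> upper_dini (A i) (v i) x \<le> ereal (- c * v i x)"
    and jump: "\<And>i j x. i \<in> {1..m} \<Longrightarrow> j \<in> {1..m} \<Longrightarrow> v i x \<le> exp d * v j x"
    and start: "\<And>i. i \<in> {1..m} \<Longrightarrow> v i x \<le> K"
    and \<sigma>: "\<sigma> \<in> switching_signals m" and "0 \<le> T" and "i \<in> {1..m}"
  shows "v i (flow A \<sigma> T x) \<le> exp (d * real (switch_count \<sigma> 0 T)) * exp (- c * T) * K"
proof -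
  have "\<forall>i\<in>{1..m}. v i (flow A \<sigma> T x) \<le> exp (d * real (switch_count \<sigma> 0 T)) * exp (- c * T) * K"
  proof (rule switching_signal_induct[OF \<sigma> \<open>0 \<le> T\<close>])
    show "\<forall>i\<in>{1..m}. v i (flow A \<sigma> 0 x) \<le> exp (d * real (switch_count \<sigma> 0 0)) * exp (- c * 0) * K"
      using start by (simp add: switch_count_def flow_solves(1)[OF \<sigma>])
  next
    fix s T :: real
    assume s: "0 \<le> s" "s < T" and const: "\<And>t. t \<in> {s..<T} \<Longrightarrow> \<sigma> t = \<sigma> s"
      and N: "switch_count \<sigma> 0 T = Suc (switch_count \<sigma> 0 s)"
      and IH: "\<forall>i\<in>{1..m}. v i (flow A \<sigma> s x) \<le> exp (d * real (switch_count \<sigma> 0 s)) * exp (- c * s) * K"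
    define k where "k = \<sigma> s"
    have k: "k \<in> {1..m}" using \<sigma> s(1) unfolding k_def switching_signals_def by blast
    have flow: "flow A \<sigma> T x = matrix_exp ((T - s) *\<^sub>R A k) *v flow A \<sigma> s x"
      by (rule flow_exp[OF \<sigma> s(1)]) (use s(2) const[folded k_def] in auto)
    show "\<forall>i\<in>{1..m}. v i (flow A \<sigma> T x) \<le> exp (d * real (switch_count \<sigma> 0 T)) * exp (- c * T) * K"
    proof
      fix i assume i: "i \<in> {1..m}"
      have "v i (flow A \<sigma> T x) \<le> exp d * v k (flow A \<sigma> T x)" by (rule jump[OF i k])
      also have "v k (flow A \<sigma> T x) \<le> exp (- c * (T - s)) * v k (flow A \<sigma> s x)"
        unfolding flow by (rule decay_of_upper_dini[OF norms[OF k] dini[OF k]]) (use s in simp)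
      also have "v k (flow A \<sigma> s x) \<le> exp (d * real (switch_count \<sigma> 0 s)) * exp (- c * s) * K"
        using IH k by blast
      finally have "v i (flow A \<sigma> T x) \<le>
          exp d * (exp (- c * (T - s)) * (exp (d * real (switch_count \<sigma> 0 s)) * exp (- c * s) * K))"
        by simp
      also have "\<dots> = exp (d + - c * (T - s) + d * real (switch_count \<sigma> 0 s) + - c * s) * K"
        by (simp only: exp_add mult.assoc)
      also have "d + - c * (T - s) + d * real (switch_count \<sigma> 0 s) + - c * s
          = d * real (switch_count \<sigma> 0 T) + - c * T"
        by (simp add: N algebra_simps)
      finally show "v i (flow A \<sigma> T x) \<le> exp (d * real (switch_count \<sigma> 0 T)) * exp (- c * T) * K"
        by (simp only: exp_add)
    qed
  qed
  with \<open>i \<in> {1..m}\<close> show ?thesis by blast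
qed

section \<open>Prepending a mode to a signal\<close>

definition prepend_mode :: "nat \<Rightarrow> real \<Rightarrow> (real \<Rightarrow> nat) \<Rightarrow> real \<Rightarrow> nat" where
  "prepend_mode j h \<sigma> t = (if t < h then j else \<sigma> (t - h))"

text \<open>No switch occurs at time \<open>h\<close> if the prepended mode is the initial mode of \<open>\<sigma>\<close>. This is what makes the
  decay of the constructed norms free of the factor \<open>exp d\<close>.\<close>
lemma prepend_mode_discontinuities:
  assumes \<sigma>: "\<sigma> \<in> switching_signals m" and "0 < h"
  shows "discontinuities (prepend_mode j h \<sigma>) \<subseteq>
    (if j = \<sigma> 0 then {} else {h}) \<union> (+) h ` discontinuities \<sigma>"
proof (rule subsetI, rule ccontr)
  fix t
  assume t: "t \<in> discontinuities (prepend_mode j h \<sigma>)"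
    and notin: "t \<notin> (if j = \<sigma> 0 then {} else {h}) \<union> (+) h ` discontinuities \<sigma>"
  have "\<exists>d>0. \<forall>s\<in>{0..}. \<bar>s - t\<bar> < d \<longrightarrow> prepend_mode j h \<sigma> s = prepend_mode j h \<sigma> t"
  proof (cases "t < h")
    case True
    then show ?thesis by (intro exI[of _ "h - t"]) (auto simp: prepend_mode_def)
  next
    case False
    have "t - h \<notin> discontinuities \<sigma>"
      using notin imageI[of "t - h" "discontinuities \<sigma>" "(+) h"] by auto
    with False have "continuous (at (t - h) within {0..}) \<sigma>" by (simp add: discontinuities_def)
    then obtain d where d: "d > 0" "\<And>s. 0 \<le> s \<Longrightarrow> \<bar>s - (t - h)\<bar> < d \<Longrightarrow> \<sigma> s = \<sigma> (t - h)"
      unfolding continuous_discrete_iff by auto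
    show ?thesis
    proof (cases "t = h")
      case True
      with notin have "j = \<sigma> 0" by (auto split: if_splits)
      have "prepend_mode j h \<sigma> s = prepend_mode j h \<sigma> t" if "\<bar>s - t\<bar> < d" for s
      proof (cases "s < h")
        case False
        with that \<open>t = h\<close> have "\<sigma> (s - h) = \<sigma> (t - h)" by (intro d(2)) auto
        with False \<open>t = h\<close> show ?thesis by (simp add: prepend_mode_def)
      qed (simp add: prepend_mode_def \<open>t = h\<close> \<open>j = \<sigma> 0\<close>)
      with d(1) show ?thesis by blast
    next
      case False
      with \<open>\<not> t < h\<close> have "0 < t - h" by simp
      have "prepend_mode j h \<sigma> s = prepend_mode j h \<sigma> t" if "\<bar>s - t\<bar> < min d (t - h)" for s
      proof -
        from that have "h < s" by (simp add: abs_less_iff)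
        moreover have "\<sigma> (s - h) = \<sigma> (t - h)" using that \<open>h < s\<close> by (intro d(2)) auto
        ultimately show ?thesis using \<open>0 < t - h\<close> by (simp add: prepend_mode_def)
      qed
      moreover have "0 < min d (t - h)" using d(1) \<open>0 < t - h\<close> by simp
      ultimately show ?thesis by blast
    qed
  qed
  with t show False
    unfolding discontinuities_def continuous_discrete_iff by blast
qed

lemma prepend_mode_signal:
  assumes \<sigma>: "\<sigma> \<in> switching_signals m" and "0 < h" and "j \<in> {1..m}"
  shows "prepend_mode j h \<sigma> \<in> switching_signals m"
  unfolding switching_signals_iff
proof (intro conjI allI impI)
  fix t :: real assume t: "0 \<le> t"
  show "prepend_mode j h \<sigma> t \<in> {1..m}"
    using \<sigma> assms(3) by (simp add: prepend_mode_def switching_signals_iff)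
  show "continuous (at_right t) (prepend_mode j h \<sigma>)"
  proof (cases "t < h")
    case True
    then show ?thesis unfolding continuous_discrete_iff
      by (intro exI[of _ "h - t"]) (auto simp: prepend_mode_def)
  next
    case False
    then have "continuous (at_right (t - h)) \<sigma>" using \<sigma> by (simp add: switching_signals_iff)
    then obtain d where d: "d > 0" "\<And>s. t - h < s \<Longrightarrow> \<bar>s - (t - h)\<bar> < d \<Longrightarrow> \<sigma> s = \<sigma> (t - h)"
      unfolding continuous_discrete_iff by auto
    have "prepend_mode j h \<sigma> s = prepend_mode j h \<sigma> t" if "t < s" "\<bar>s - t\<bar> < d" for s
    proof -
      have "\<sigma> (s - h) = \<sigma> (t - h)" using that by (intro d(2)) auto
      with that False show ?thesis by (simp add: prepend_mode_def)
    qed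
    with d(1) show ?thesis unfolding continuous_discrete_iff by blast
  qed
next
  fix a b
  have "finite (discontinuities \<sigma> \<inter> {a - h..b - h})" using \<sigma> by (simp add: switching_signals_iff)
  then have "finite (insert h ((+) h ` (discontinuities \<sigma> \<inter> {a - h..b - h})))" by simp
  moreover have "discontinuities (prepend_mode j h \<sigma>) \<inter> {a..b} \<subseteq>
      insert h ((+) h ` (discontinuities \<sigma> \<inter> {a - h..b - h}))"
    using prepend_mode_discontinuities[OF \<sigma> assms(2), of j] by (auto split: if_splits)
  ultimately show "finite (discontinuities (prepend_mode j h \<sigma>) \<inter> {a..b})"
    by (rule finite_subset[rotated])
qed

text \<open>The flow under the longer signal, read from time \<open>h\<close> on, solves the equation for \<open>\<sigma>\<close>.\<close>
lemma flow_prepend_mode: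
  fixes A :: "nat \<Rightarrow> real^'n^'n"
  assumes \<sigma>: "\<sigma> \<in> switching_signals m" and "0 < h" and "j \<in> {1..m}" and "0 \<le> t"
  shows "flow A (prepend_mode j h \<sigma>) (t + h) x = flow A \<sigma> t (matrix_exp (h *\<^sub>R A j) *v x)"
proof -
  let ?\<sigma> = "prepend_mode j h \<sigma>"
  let ?\<phi> = "\<lambda>t. flow A ?\<sigma> t x"
  have \<sigma>': "?\<sigma> \<in> switching_signals m" by (rule prepend_mode_signal) fact+
  have "flow A ?\<sigma> h x = matrix_exp ((h - 0) *\<^sub>R A j) *v flow A ?\<sigma> 0 x"
    by (rule flow_exp[OF \<sigma>']) (use assms(2) in \<open>auto simp: prepend_mode_def\<close>)
  then have init: "?\<phi> (0 + h) = matrix_exp (h *\<^sub>R A j) *v x" by (simp add: flow_solves(1)[OF \<sigma>'])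
  have sol: "solves_on A ?\<sigma> 0 (t + h) ?\<phi>" by (rule flow_solves(2)[OF \<sigma>'])
  have "solves_on A \<sigma> 0 t (\<lambda>s. ?\<phi> (s + h))"
    unfolding solves_on_def
  proof (intro conjI ballI)
    show "continuous_on {0..t} (\<lambda>s. ?\<phi> (s + h))"
      by (rule continuous_on_compose2[of "{0..t + h}" ?\<phi>])
         (use sol assms(2) in \<open>auto simp: solves_on_def intro!: continuous_intros\<close>)
  next
    fix s assume s: "s \<in> {0<..<t} - discontinuities \<sigma>"
    then have "s + h \<notin> discontinuities ?\<sigma>"
      using prepend_mode_discontinuities[OF \<sigma> assms(2), of j] by (auto split: if_splits)
    with s assms(2) have "s + h \<in> {0<..<t + h} - discontinuities ?\<sigma>" by auto
    with sol have "(?\<phi> has_vector_derivative A (?\<sigma> (s + h)) *v ?\<phi> (s + h)) (at (s + h))"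
      unfolding solves_on_def by blast
    moreover have "?\<sigma> (s + h) = \<sigma> s" using s by (simp add: prepend_mode_def)
    moreover have "((\<lambda>s. s + h) has_vector_derivative 1) (at s)"
      by (auto intro!: derivative_eq_intros)
    ultimately show "((\<lambda>s. ?\<phi> (s + h)) has_vector_derivative A (\<sigma> s) *v ?\<phi> (s + h)) (at s)"
      using vector_diff_chain_at[of "\<lambda>s. s + h" 1 s ?\<phi>] by (simp add: o_def)
  qed
  from flow_eq[OF \<sigma> assms(4) this] show ?thesis unfolding init by simp
qed

lemma constant_signal:
  assumes "i \<in> {1..m}"
  shows "(\<lambda>_. i) \<in> switching_signals m"
  using assms by (simp add: switching_signals_def discontinuities_def)

section \<open>From exponential boundedness to norms\<close>

text \<open>Up to the constant factor, the reciprocal of the growth that uniform exponential boundedness allows,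
  except that time \<open>0\<close> is not counted as a switch; so prepending the mode that is already active costs no switch.\<close>
definition gain :: "real \<Rightarrow> real \<Rightarrow> (real \<Rightarrow> nat) \<Rightarrow> real \<Rightarrow> real" where
  "gain c d \<sigma> t = exp (c * t - d * real (card (discontinuities \<sigma> \<inter> {0..<t})))"

lemma gain_prepend_mode:
  assumes \<sigma>: "\<sigma> \<in> switching_signals m" and "0 < h" and "0 \<le> d"
  shows "exp (c * h) * gain c d \<sigma> t \<le>
    exp (d * of_bool (j \<noteq> \<sigma> 0)) * gain c d (prepend_mode j h \<sigma>) (t + h)"
proof -
  let ?D = "discontinuities \<sigma> \<inter> {0..<t}" and ?D' = "discontinuities (prepend_mode j h \<sigma>) \<inter> {0..<t + h}"
  let ?E = "if j = \<sigma> 0 then {} else {h}"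
  have "finite (discontinuities \<sigma> \<inter> {0..t})" using \<sigma> by (simp add: switching_signals_iff)
  then have fin: "finite ?D" by (rule finite_subset[rotated]) auto
  have "?D' \<subseteq> ?E \<union> (+) h ` ?D"
    using prepend_mode_discontinuities[OF \<sigma> assms(2), of j]
    by (auto simp: discontinuities_def split: if_splits)
  then have "card ?D' \<le> card (?E \<union> (+) h ` ?D)" using fin by (intro card_mono) auto
  also have "\<dots> \<le> card ?E + card ((+) h ` ?D)" by (rule card_Un_le)
  also have "\<dots> = of_bool (j \<noteq> \<sigma> 0) + card ?D" by (simp add: card_image)
  finally have "real (card ?D') \<le> real (of_bool (j \<noteq> \<sigma> 0) + card ?D)" by (rule of_nat_mono)
  then have "real (card ?D') \<le> of_bool (j \<noteq> \<sigma> 0) + real (card ?D)" by simp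
  then have "d * real (card ?D') \<le> d * (of_bool (j \<noteq> \<sigma> 0) + real (card ?D))"
    using assms(3) by (rule mult_left_mono)
  then have "c * h + (c * t - d * real (card ?D)) \<le> d * of_bool (j \<noteq> \<sigma> 0) + (c * (t + h) - d * real (card ?D'))"
    unfolding distrib_left by linarith
  then show ?thesis
    unfolding gain_def exp_add[symmetric] by (simp only: exp_le_cancel_iff)
qed

text \<open>The converse Lyapunov norm of mode \<open>i\<close>: the supremum of the weighted norms of
  all states that can be reached from \<open>x\<close> when the system starts in mode \<open>i\<close>.\<close>
definition worst_growth ::
  "nat \<Rightarrow> (nat \<Rightarrow> real^'n^'n) \<Rightarrow> real \<Rightarrow> real \<Rightarrow> nat \<Rightarrow> real^'n \<Rightarrow> real" where
  "worst_growth m A c d i x =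
     (SUP (\<sigma>, t)\<in>{\<sigma> \<in> switching_signals m. \<sigma> 0 = i} \<times> {0..}. gain c d \<sigma> t * norm (flow A \<sigma> t x))"

lemma worst_growth_upper:
  fixes A :: "nat \<Rightarrow> real^'n^'n"
  assumes bound: "\<forall>\<sigma>\<in>switching_signals m. \<forall>t\<ge>0. \<forall>x. gain c d \<sigma> t * norm (flow A \<sigma> t x) \<le> K * norm x"
    and "\<sigma> \<in> switching_signals m" and "0 \<le> t"
  shows "gain c d \<sigma> t * norm (flow A \<sigma> t x) \<le> worst_growth m A c d (\<sigma> 0) x"
proof -
  have "bdd_above ((\<lambda>(\<sigma>, t). gain c d \<sigma> t * norm (flow A \<sigma> t x)) `
      ({\<sigma>' \<in> switching_signals m. \<sigma>' 0 = \<sigma> 0} \<times> {0..}))"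
    by (rule bdd_aboveI[of _ "K * norm x"]) (use bound in auto)
  from cSUP_upper[OF _ this, of "(\<sigma>, t)"] assms(2,3) show ?thesis by (simp add: worst_growth_def)
qed

lemma worst_growth_least:
  fixes A :: "nat \<Rightarrow> real^'n^'n"
  assumes "i \<in> {1..m}"
    and "\<And>\<sigma> t. \<sigma> \<in> switching_signals m \<Longrightarrow> \<sigma> 0 = i \<Longrightarrow> 0 \<le> t \<Longrightarrow> gain c d \<sigma> t * norm (flow A \<sigma> t x) \<le> b"
  shows "worst_growth m A c d i x \<le> b"
  unfolding worst_growth_def
proof (rule cSUP_least)
  show "{\<sigma> \<in> switching_signals m. \<sigma> 0 = i} \<times> {0::real..} \<noteq> {}"
    using constant_signal[OF assms(1)] by auto
qed (use assms(2) in auto)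

text \<open>A supremum of seminorms, by linearity of the flow. Time \<open>0\<close> contributes \<open>norm x\<close>, which gives
  definiteness.\<close>
lemma worst_growth_is_norm:
  fixes A :: "nat \<Rightarrow> real^'n^'n"
  assumes bound: "\<forall>\<sigma>\<in>switching_signals m. \<forall>t\<ge>0. \<forall>x. gain c d \<sigma> t * norm (flow A \<sigma> t x) \<le> K * norm x"
    and i: "i \<in> {1..m}"
  shows "is_norm (worst_growth m A c d i)"
proof -
  let ?v = "worst_growth m A c d i"
  note upper = worst_growth_upper[where A = A, OF bound]
  note least = worst_growth_least[where A = A, OF i]
  have lower: "norm x \<le> ?v x" for x
    using upper[OF constant_signal[OF i] order_refl, of x]
    by (simp add: gain_def flow_solves(1)[OF constant_signal[OF i]])
  have at_zero: "?v 0 \<le> 0"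
    by (rule least) (use bound[rule_format, of _ _ 0] in simp)
  have scale_le: "?v (r *\<^sub>R x) \<le> \<bar>r\<bar> * ?v x" for r x
  proof (rule least)
    fix \<sigma> and t :: real assume \<sigma>: "\<sigma> \<in> switching_signals m" "\<sigma> 0 = i" and t: "0 \<le> t"
    have "gain c d \<sigma> t * norm (flow A \<sigma> t (r *\<^sub>R x)) = \<bar>r\<bar> * (gain c d \<sigma> t * norm (flow A \<sigma> t x))"
      by (simp add: flow_scaleR[OF \<sigma>(1) t])
    also have "\<dots> \<le> \<bar>r\<bar> * ?v x"
      using upper[OF \<sigma>(1) t, of x] \<sigma>(2) by (intro mult_left_mono) auto
    finally show "gain c d \<sigma> t * norm (flow A \<sigma> t (r *\<^sub>R x)) \<le> \<bar>r\<bar> * ?v x" .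
  qed
  have scale: "?v (r *\<^sub>R x) = \<bar>r\<bar> * ?v x" for r x
  proof (cases "r = 0")
    case True
    with at_zero lower[of 0] show ?thesis by simp
  next
    case False
    have "\<bar>r\<bar> * ?v x = \<bar>r\<bar> * ?v (inverse r *\<^sub>R (r *\<^sub>R x))" using False by simp
    also have "\<dots> \<le> \<bar>r\<bar> * (\<bar>inverse r\<bar> * ?v (r *\<^sub>R x))"
      by (intro mult_left_mono scale_le) simp
    also have "\<dots> = ?v (r *\<^sub>R x)" using False by (simp add: abs_inverse)
    finally show ?thesis using scale_le[of r x] by simp
  qed
  have triangle: "?v (x + y) \<le> ?v x + ?v y" for x y
  proof (rule least)
    fix \<sigma> and t :: real assume \<sigma>: "\<sigma> \<in> switching_signals m" "\<sigma> 0 = i" and t: "0 \<le> t"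
    have "gain c d \<sigma> t * norm (flow A \<sigma> t (x + y)) \<le>
        gain c d \<sigma> t * (norm (flow A \<sigma> t x) + norm (flow A \<sigma> t y))"
      unfolding flow_add[OF \<sigma>(1) t]
      by (intro mult_left_mono norm_triangle_ineq) (simp add: gain_def)
    also have "\<dots> \<le> ?v x + ?v y"
      using upper[OF \<sigma>(1) t, of x] upper[OF \<sigma>(1) t, of y] \<sigma>(2) by (simp add: distrib_left)
    finally show "gain c d \<sigma> t * norm (flow A \<sigma> t (x + y)) \<le> ?v x + ?v y" .
  qed
  have "?v x = 0 \<longleftrightarrow> x = 0" for x
  proof
    assume "?v x = 0"
    with lower[of x] show "x = 0" by simp
  next
    assume "x = 0"
    with at_zero lower[of x] show "?v x = 0" by simp
  qed
  moreover have "0 \<le> ?v x" for x using lower[of x] norm_ge_zero[of x] by linarith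
  ultimately show ?thesis
    unfolding is_norm_def using scale triangle by blast
qed

text \<open>Everything reachable from \<open>matrix_exp (h *\<^sub>R A j) *v x\<close> is reachable from \<open>x\<close> by first staying in mode
  \<open>j\<close> for time \<open>h\<close>. With \<open>j = i\<close> this is the decay of the norm of mode \<open>i\<close>; with \<open>j \<noteq> i\<close> and \<open>h\<close> tending to
  \<open>0\<close> it is the comparison of two norms.\<close>
lemma worst_growth_prepend:
  fixes A :: "nat \<Rightarrow> real^'n^'n"
  assumes bound: "\<forall>\<sigma>\<in>switching_signals m. \<forall>t\<ge>0. \<forall>x. gain c d \<sigma> t * norm (flow A \<sigma> t x) \<le> K * norm x"
    and i: "i \<in> {1..m}" and j: "j \<in> {1..m}" and "0 < h" and "0 \<le> d"
  shows "worst_growth m A c d i (matrix_exp (h *\<^sub>R A j) *v x) \<le>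
    exp (- c * h) * exp (d * of_bool (j \<noteq> i)) * worst_growth m A c d j x"
proof (rule worst_growth_least[OF i])
  fix \<sigma> and t :: real assume \<sigma>: "\<sigma> \<in> switching_signals m" "\<sigma> 0 = i" and t: "0 \<le> t"
  let ?\<sigma> = "prepend_mode j h \<sigma>"
  have \<sigma>': "?\<sigma> \<in> switching_signals m" by (rule prepend_mode_signal[OF \<sigma>(1) \<open>0 < h\<close> j])
  have "?\<sigma> 0 = j" using \<open>0 < h\<close> by (simp add: prepend_mode_def)
  with worst_growth_upper[where A = A, OF bound \<sigma>', of "t + h" x] t \<open>0 < h\<close>
  have up: "gain c d ?\<sigma> (t + h) * norm (flow A ?\<sigma> (t + h) x) \<le> worst_growth m A c d j x" by simp
  have "exp (- c * h) * (exp (c * h) * gain c d \<sigma> t) \<le>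
      exp (- c * h) * (exp (d * of_bool (j \<noteq> i)) * gain c d ?\<sigma> (t + h))"
    using gain_prepend_mode[OF \<sigma>(1) \<open>0 < h\<close> \<open>0 \<le> d\<close>, of c t j] \<sigma>(2) by (intro mult_left_mono) auto
  also have "exp (- c * h) * (exp (c * h) * gain c d \<sigma> t) = gain c d \<sigma> t"
    by (simp add: mult.assoc[symmetric] exp_add[symmetric])
  finally have "gain c d \<sigma> t * norm (flow A ?\<sigma> (t + h) x) \<le>
      exp (- c * h) * (exp (d * of_bool (j \<noteq> i)) * gain c d ?\<sigma> (t + h)) * norm (flow A ?\<sigma> (t + h) x)"
    by (rule mult_right_mono) simp
  also have "\<dots> = exp (- c * h) * exp (d * of_bool (j \<noteq> i)) * (gain c d ?\<sigma> (t + h) * norm (flow A ?\<sigma> (t + h) x))"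
    by (simp only: mult.assoc)
  also have "\<dots> \<le> exp (- c * h) * exp (d * of_bool (j \<noteq> i)) * worst_growth m A c d j x"
    by (rule mult_left_mono[OF up]) simp
  finally show "gain c d \<sigma> t * norm (flow A \<sigma> t (matrix_exp (h *\<^sub>R A j) *v x)) \<le>
      exp (- c * h) * exp (d * of_bool (j \<noteq> i)) * worst_growth m A c d j x"
    by (simp only: flow_prepend_mode[OF \<sigma>(1) \<open>0 < h\<close> j t])
qed

text \<open>Prepending mode \<open>j\<close> for an infinitesimal time costs one switch: let \<open>h\<close> tend to \<open>0\<close> in
  \<open>worst_growth_prepend\<close>, using that norms are continuous.\<close>
lemma worst_growth_jump:
  fixes A :: "nat \<Rightarrow> real^'n^'n"
  assumes bound: "\<forall>\<sigma>\<in>switching_signals m. \<forall>t\<ge>0. \<forall>x. gain c d \<sigma> t * norm (flow A \<sigma> t x) \<le> K * norm x"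
    and i: "i \<in> {1..m}" and j: "j \<in> {1..m}" and "0 \<le> d"
  shows "worst_growth m A c d i x \<le> exp d * worst_growth m A c d j x"
proof (rule tendsto_le[OF trivial_limit_at_right_real])
  let ?v = "worst_growth m A c d"
  have norm: "is_norm (?v k)" if "k \<in> {1..m}" for k
    by (rule worst_growth_is_norm[OF bound that])
  have "continuous_on UNIV (\<lambda>h. matrix_exp (h *\<^sub>R A j) *v x)"
    by (rule continuous_on_vector_derivative) (rule matrix_exp_trajectory[where s=0, simplified])
  then have "continuous_on UNIV (\<lambda>h. ?v i (matrix_exp (h *\<^sub>R A j) *v x))"
    by (rule continuous_on_compose2[OF is_norm_continuous[OF norm[OF i], of UNIV]]) simp
  then have "((\<lambda>h. ?v i (matrix_exp (h *\<^sub>R A j) *v x)) \<longlongrightarrow> ?v i (matrix_exp (0 *\<^sub>R A j) *v x)) (at 0)"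
    unfolding continuous_on_def by blast
  then show "((\<lambda>h. ?v i (matrix_exp (h *\<^sub>R A j) *v x)) \<longlongrightarrow> ?v i x) (at_right 0)"
    by (rule filterlim_mono) (simp_all add: matrix_exp_zero at_le)
  have "((\<lambda>h. exp (- c * h) * exp d * ?v j x) \<longlongrightarrow> exp (- c * 0) * exp d * ?v j x) (at_right 0)"
    by (intro tendsto_intros)
  then show "((\<lambda>h. exp (- c * h) * exp d * ?v j x) \<longlongrightarrow> exp d * ?v j x) (at_right 0)" by simp
  show "\<forall>\<^sub>F h in at_right 0. ?v i (matrix_exp (h *\<^sub>R A j) *v x) \<le> exp (- c * h) * exp d * ?v j x"
  proof (rule eventually_mono[OF eventually_at_right_less])
    fix h :: real assume "0 < h"
    from worst_growth_prepend[OF bound i j this \<open>0 \<le> d\<close>, of x]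
    have "?v i (matrix_exp (h *\<^sub>R A j) *v x) \<le> exp (- c * h) * exp (d * of_bool (j \<noteq> i)) * ?v j x" .
    also have "\<dots> \<le> exp (- c * h) * exp d * ?v j x"
      using \<open>0 \<le> d\<close> is_normD(1)[OF norm[OF j]] by (intro mult_right_mono mult_left_mono) auto
    finally show "?v i (matrix_exp (h *\<^sub>R A j) *v x) \<le> exp (- c * h) * exp d * ?v j x" .
  qed
qed

text \<open>The factor \<open>exp d\<close> pays for the switch at time \<open>0\<close>, which \<open>switch_count\<close> counts and \<open>gain\<close> does not.\<close>
lemma UGEB_gain_bound:
  assumes "0 \<le> d" and "0 \<le> M" and \<sigma>: "\<sigma> \<in> switching_signals m" and "0 \<le> t"
    and bound: "norm (flow A \<sigma> t x) \<le> M * exp (d * real (switch_count \<sigma> 0 t)) * exp (- c * t) * norm x"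
  shows "gain c d \<sigma> t * norm (flow A \<sigma> t x) \<le> M * exp d * norm x"
proof -
  let ?N = "card (discontinuities \<sigma> \<inter> {0..<t})"
  have "finite (discontinuities \<sigma> \<inter> {0..t})" using \<sigma> by (simp add: switching_signals_iff)
  then have "finite (discontinuities \<sigma> \<inter> {0..<t})" by (rule finite_subset[rotated]) auto
  then have "card (insert 0 (discontinuities \<sigma>) \<inter> {0..<t}) \<le> card (insert 0 (discontinuities \<sigma> \<inter> {0..<t}))"
    by (intro card_mono) auto
  also have "\<dots> \<le> Suc ?N" by (rule card_insert_le_m1) simp_all
  finally have "real (switch_count \<sigma> 0 t) \<le> 1 + real ?N" by (simp add: switch_count_def)
  then have N: "d * real (switch_count \<sigma> 0 t) \<le> d * (1 + real ?N)"
    using \<open>0 \<le> d\<close> by (rule mult_left_mono)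
  have "gain c d \<sigma> t * norm (flow A \<sigma> t x) \<le>
      gain c d \<sigma> t * (M * exp (d * real (switch_count \<sigma> 0 t)) * exp (- c * t) * norm x)"
    by (rule mult_left_mono[OF bound]) (simp add: gain_def)
  also have "\<dots> = M * exp (c * t - d * real ?N + d * real (switch_count \<sigma> 0 t) + - c * t) * norm x"
    unfolding gain_def exp_add by (simp only: mult_ac)
  also have "\<dots> \<le> M * exp d * norm x"
    using N \<open>0 \<le> M\<close> by (intro mult_right_mono mult_left_mono) (auto simp: algebra_simps)
  finally show ?thesis .
qed

theorem corollary1:
  fixes m :: nat and A :: "nat \<Rightarrow> real^'n^'n" and \<tau> \<rho> :: real
  assumes "m \<ge> 1" and "\<tau> > 0" and "\<rho> > 0"
  shows "UGEB m A \<tau> \<rho> \<longleftrightarrow>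
    (\<exists>(v :: nat \<Rightarrow> real^'n \<Rightarrow> real) \<alpha>. \<alpha> \<ge> 0 \<and>
       (\<forall>i\<in>{1..m}. is_norm (v i)) \<and>
       (\<forall>i\<in>{1..m}. \<forall>x. upper_dini (A i) (v i) x \<le> ereal (- (\<rho> + \<alpha>) * v i x)) \<and>
       (\<forall>x. \<forall>(i, j)\<in>{1..m} \<times> {1..m}. v i x \<le> exp (\<alpha> * \<tau>) * v j x))"
    (is "_ \<longleftrightarrow> (\<exists>v \<alpha>. ?norms v \<alpha>)")
proof
  assume "UGEB m A \<tau> \<rho>"
  then obtain M \<alpha> where "M > 0" and "\<alpha> \<ge> 0"
    and UGEB: "\<And>\<sigma> x t. \<sigma> \<in> switching_signals m \<Longrightarrow> 0 \<le> t \<Longrightarrow> norm (flow A \<sigma> t x) \<le>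
          M * exp (\<alpha> * \<tau> * real (switch_count \<sigma> 0 t)) * exp (- (\<rho> + \<alpha>) * t) * norm x"
    unfolding UGEB_def by blast
  have d: "0 \<le> \<alpha> * \<tau>" using \<open>\<alpha> \<ge> 0\<close> \<open>\<tau> > 0\<close> by simp
  have bound: "\<forall>\<sigma>\<in>switching_signals m. \<forall>t\<ge>0. \<forall>x.
      gain (\<rho> + \<alpha>) (\<alpha> * \<tau>) \<sigma> t * norm (flow A \<sigma> t x) \<le> (M * exp (\<alpha> * \<tau>)) * norm x"
    using UGEB_gain_bound[OF d less_imp_le[OF \<open>M > 0\<close>] _ _ UGEB] by blast
  let ?v = "worst_growth m A (\<rho> + \<alpha>) (\<alpha> * \<tau>)"
  have "upper_dini (A i) (?v i) x \<le> ereal (- (\<rho> + \<alpha>) * ?v i x)" if i: "i \<in> {1..m}" for i x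
    by (rule upper_dini_of_decay) (use worst_growth_prepend[OF bound i i _ d] in simp)
  with \<open>\<alpha> \<ge> 0\<close> have "?norms ?v \<alpha>"
    using worst_growth_is_norm[OF bound] worst_growth_jump[OF bound _ _ d] by blast
  then show "\<exists>v \<alpha>. ?norms v \<alpha>" by blast
next
  assume "\<exists>v \<alpha>. ?norms v \<alpha>"
  then obtain v \<alpha> where v: "?norms v \<alpha>" by blast
  then have "\<alpha> \<ge> 0"
    and norms: "\<And>i. i \<in> {1..m} \<Longrightarrow> is_norm (v i)"
    and dini: "\<And>i x. i \<in> {1..m} \<Longrightarrow> upper_dini (A i) (v i) x \<le> ereal (- (\<rho> + \<alpha>) * v i x)"
    by blast+
  have jump: "v i x \<le> exp (\<alpha> * \<tau>) * v j x" if "i \<in> {1..m}" "j \<in> {1..m}" for i j x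
  proof -
    from v have "\<forall>(i, j)\<in>{1..m} \<times> {1..m}. v i x \<le> exp (\<alpha> * \<tau>) * v j x" by blast
    with that show ?thesis by auto
  qed
  \<comment> \<open>Equivalence with the Euclidean norm is needed for one mode only: \<open>jump\<close> compares the others with it.\<close>
  have one: "1 \<in> {1..m}" using \<open>m \<ge> 1\<close> by simp
  obtain a where a: "a > 0" "\<And>x. norm x \<le> a * v 1 x" using is_norm_lower_bound[OF norms[OF one]] by blast
  obtain b where b: "b > 0" "\<And>x. v 1 x \<le> b * norm x" using is_norm_upper_bound[OF norms[OF one]] by blast
  let ?M = "a * (exp (\<alpha> * \<tau>) * b)"
  have "norm (flow A \<sigma> t x) \<le>
      ?M * exp (\<alpha> * \<tau> * real (switch_count \<sigma> 0 t)) * exp (- (\<rho> + \<alpha>) * t) * norm x"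
    if "\<sigma> \<in> switching_signals m" "0 \<le> t" for \<sigma> x t
  proof -
    have start: "v i x \<le> exp (\<alpha> * \<tau>) * (b * norm x)" if "i \<in> {1..m}" for i
      by (rule order_trans[OF jump[OF that one]]) (intro mult_left_mono b exp_ge_zero)
    have growth: "v 1 (flow A \<sigma> t x) \<le> exp (\<alpha> * \<tau> * real (switch_count \<sigma> 0 t)) * exp (- (\<rho> + \<alpha>) * t) *
        (exp (\<alpha> * \<tau>) * (b * norm x))"
      by (rule flow_bound_of_multiple_norms[where m = m]) (fact norms dini jump start that one)+
    have "norm (flow A \<sigma> t x) \<le> a * v 1 (flow A \<sigma> t x)" by (rule a)
    also have "\<dots> \<le> a * (exp (\<alpha> * \<tau> * real (switch_count \<sigma> 0 t)) * exp (- (\<rho> + \<alpha>) * t) *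
        (exp (\<alpha> * \<tau>) * (b * norm x)))"
      using a(1) by (intro mult_left_mono[OF growth]) simp
    finally show ?thesis by (simp only: mult_ac)
  qed
  moreover have "?M > 0" using a(1) b(1) by simp
  ultimately show "UGEB m A \<tau> \<rho>"
    unfolding UGEB_def using \<open>\<alpha> \<ge> 0\<close> by blast
qed

end
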